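(* Let $d\ge 1$ and let $\mathbb{T}=(T_{ij})$ be a $d\times d$ operator matrix where $T_{ij}\in\mathcal{B}_A(\mathcal{H})$ for all $i,j\in\{1,\dots,d\}$, regarded as an operator on $\mathbb{H}=\oplus_{i=1}^d\mathcal{H}$. Then $$\omega_{\mathbb{A}}(\mathbb{T})\leq \frac{1}{2}\sum_{i=1}^d\left(\omega_A(T_{ii})+\sqrt{\omega_A^2(T_{ii})+\sum_{j=1,\,j\neq i}^{d}\|T_{ij}\|_A^2}\right),$$ where $\omega_A^2(T_{ii})=(\omega_A(T_{ii}))^2$.
   Context: $(\mathcal{H},\langle\cdot\mid\cdot\rangle)$ is a non-trivial complex Hilbert space, $\mathcal{B}(\mathcal{H})$ is the algebra of bounded linear operators on $\mathcal{H}$, and $A\in\mathcal{B}(\mathcal{H})$ is a fixed nonzero positive (semidefinite) operator. Put $\langle x\mid y\rangle_A=\langle Ax\mid y\rangle$ and $\|x\|_A=\langle x\mid x\rangle_A^{1/2}$. An operator $T\in\mathcal{B}(\mathcal{H})$ is $A$-bounded, written $T\in\mathcal{B}_{A^{1/2}}(\mathcal{H})$, if there is $\lambda>0$ with $\|Tx\|_A\le\lambda\|x\|_A$ for all $x\in\mathcal{H}$. For such $T$, $\|T\|_A=\sup\{\|Tx\|_A : x\in\mathcal{H},\ \|x\|_A=1\}$ and the $A$-numerical radius is $\omega_A(T)=\sup\{|\langle Tx\mid x\rangle_A| : x\in\mathcal{H},\ \|x\|_A=1\}$. $\mathcal{B}_A(\mathcal{H})$ is the set of $T\in\mathcal{B}(\mathcal{H})$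 for which the equation $AX=T^*A$ has a solution $X\in\mathcal{B}(\mathcal{H})$ (equivalently $\mathcal{R}(T^*A)\subset\mathcal{R}(A)$, where $\mathcal{R}$ denotes range); one has $\mathcal{B}_A(\mathcal{H})\subseteq\mathcal{B}_{A^{1/2}}(\mathcal{H})$. $\mathbb{H}=\oplus_{i=1}^d\mathcal{H}$ has the inner product $\langle x,y\rangle=\sum_{k=1}^d\langle x_k\mid y_k\rangle$, and $\mathbb{A}$ is the $d\times d$ diagonal operator matrix on $\mathbb{H}$ with every diagonal entry equal to $A$. $\omega_{\mathbb{A}}$ is the notion above with $(\mathbb{H},\mathbb{A})$ in place of $(\mathcal{H},A)$. *)

theory Defs
  imports "HOL-Analysis.Analysis"
begin

section \<open>Complex Hilbert spaces\<close>

class complex_vector = real_vector +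
  fixes scaleC :: "complex \<Rightarrow> 'a \<Rightarrow> 'a"  (infixr \<open>*\<^sub>C\<close> 75)
  assumes scaleC_add_right: "a *\<^sub>C (x + y) = a *\<^sub>C x + a *\<^sub>C y"
    and scaleC_add_left: "(a + b) *\<^sub>C x = a *\<^sub>C x + b *\<^sub>C x"
    and scaleC_scaleC: "a *\<^sub>C b *\<^sub>C x = (a * b) *\<^sub>C x"
    and scaleC_one: "1 *\<^sub>C x = x"
    and scaleR_scaleC: "r *\<^sub>R x = complex_of_real r *\<^sub>C x"

text \<open>
  The inner product is linear in its first argument. The norm is the one of
  \<^class>\<open>real_inner\<close>, whose inner product is the real part of the complex one;
  since \<^term>\<open>cinner x x\<close> is real by conjugate symmetry, positive definiteness and
  the identity of the squared norm with \<^term>\<open>cinner x x\<close> are inherited.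
\<close>

class complex_inner = complex_vector + real_inner +
  fixes cinner :: "'a \<Rightarrow> 'a \<Rightarrow> complex"
  assumes cinner_commute: "cinner x y = cnj (cinner y x)"
    and cinner_add_left: "cinner (x + y) z = cinner x z + cinner y z"
    and cinner_scaleC_left: "cinner (a *\<^sub>C x) y = a * cinner x y"
    and Re_cinner: "Re (cinner x y) = inner x y"

lemma (in complex_inner) cinner_self: "cinner x x = complex_of_real ((norm x)\<^sup>2)"
proof (rule complex_eqI)
  show "Re (cinner x x) = Re (complex_of_real ((norm x)\<^sup>2))"
    by (simp add: Re_cinner power2_norm_eq_inner)
  have "Im (cinner x x) = - Im (cinner x x)"
    using arg_cong[OF cinner_commute[of x x], of Im] by simp
  then show "Im (cinner x x) = Im (complex_of_real ((norm x)\<^sup>2))"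
    by simp
qed

class chilbert_space = complex_inner + complete_space

instantiation complex :: chilbert_space
begin

definition scaleC_complex :: "complex \<Rightarrow> complex \<Rightarrow> complex"
  where "scaleC_complex a x = a * x"

definition cinner_complex :: "complex \<Rightarrow> complex \<Rightarrow> complex"
  where "cinner_complex x y = x * cnj y"

instance
  by standard
    (auto simp: scaleC_complex_def cinner_complex_def inner_complex_def algebra_simps
      scaleR_conv_of_real)

end

text \<open>
  The direct sum of \<open>d\<close> copies of \<open>'a\<close> is \<open>'a ^ 'd\<close> with \<open>d = CARD('d)\<close>; its
  library norm is already the \<open>\<ell>\<^sup>2\<close> norm.
\<close>

instantiation vec :: (complex_inner, finite) complex_inner
begin

definition scaleC_vec :: "complex \<Rightarrow> 'a ^ 'b \<Rightarrow> 'a ^ 'b"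
  where "scaleC_vec a x = (\<chi> i. a *\<^sub>C (x $ i))"

definition cinner_vec :: "'a ^ 'b \<Rightarrow> 'a ^ 'b \<Rightarrow> complex"
  where "cinner_vec x y = (\<Sum>i\<in>UNIV. cinner (x $ i) (y $ i))"

instance
proof
  fix a b :: complex and r :: real and x y z :: "'a ^ 'b"
  show "a *\<^sub>C (x + y) = a *\<^sub>C x + a *\<^sub>C y"
    by (simp add: scaleC_vec_def vec_eq_iff scaleC_add_right)
  show "(a + b) *\<^sub>C x = a *\<^sub>C x + b *\<^sub>C x"
    by (simp add: scaleC_vec_def vec_eq_iff scaleC_add_left)
  show "a *\<^sub>C b *\<^sub>C x = (a * b) *\<^sub>C x"
    by (simp add: scaleC_vec_def vec_eq_iff scaleC_scaleC)
  show "1 *\<^sub>C x = x"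
    by (simp add: scaleC_vec_def vec_eq_iff scaleC_one)
  show "r *\<^sub>R x = complex_of_real r *\<^sub>C x"
    by (simp add: scaleC_vec_def vec_eq_iff scaleR_scaleC)
  show "cinner x y = cnj (cinner y x)"
    unfolding cinner_vec_def cnj_sum by (intro sum.cong refl cinner_commute)
  show "cinner (x + y) z = cinner x z + cinner y z"
    by (simp add: cinner_vec_def cinner_add_left sum.distrib)
  show "cinner (a *\<^sub>C x) y = a * cinner x y"
    by (simp add: cinner_vec_def scaleC_vec_def cinner_scaleC_left sum_distrib_left)
  show "Re (cinner x y) = inner x y"
    by (simp add: cinner_vec_def inner_vec_def Re_cinner)
qed

end

instance vec :: (chilbert_space, finite) chilbert_space ..


section \<open>Bounded, positive and adjoint operators\<close>

locale bounded_clinear = bounded_linear f for f :: "'a::complex_inner \<Rightarrow> 'b::complex_inner" +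
  assumes scaleC: "f (c *\<^sub>C x) = c *\<^sub>C f x"

definition positive_op :: "('a::complex_inner \<Rightarrow> 'a) \<Rightarrow> bool"
  where "positive_op A \<longleftrightarrow> bounded_clinear A \<and> (\<forall>x. cinner (A x) x \<in> \<real>\<^sub>\<ge>\<^sub>0)"

text \<open>
  On \<^class>\<open>chilbert_space\<close> every bounded operator has exactly one adjoint, by the
  Riesz representation theorem; the choice is therefore determined.
\<close>

definition cadjoint :: "('a::chilbert_space \<Rightarrow> 'b::chilbert_space) \<Rightarrow> 'b \<Rightarrow> 'a"
  where "cadjoint T = (SOME S. \<forall>x y. cinner (T x) y = cinner x (S y))"


section \<open>The semi-inner product induced by a positive operator\<close>

definition ainner :: "('a::complex_inner \<Rightarrow> 'a) \<Rightarrow> 'a \<Rightarrow> 'a \<Rightarrow> complex"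
  where "ainner A x y = cinner (A x) y"

definition anorm :: "('a::complex_inner \<Rightarrow> 'a) \<Rightarrow> 'a \<Rightarrow> real"
  where "anorm A x = sqrt (Re (ainner A x x))"

definition B_A :: "('a::chilbert_space \<Rightarrow> 'a) \<Rightarrow> ('a \<Rightarrow> 'a) set"
  where "B_A A = {T. bounded_clinear T \<and> (\<exists>X. bounded_clinear X \<and> A \<circ> X = cadjoint T \<circ> A)}"

text \<open>
  The suprema below are taken in the reals. They are the intended ones when \<open>A\<close> is
  a nonzero positive operator and \<open>T\<close> is \<open>A\<close>-bounded, i.e. \<open>anorm A (T x) \<le> \<lambda> * anorm A x\<close>
  for some \<open>\<lambda> > 0\<close> and all \<open>x\<close>: the sets are then nonempty and bounded above. Every
  element of \<open>B_A A\<close> is \<open>A\<close>-bounded.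
\<close>

definition aopnorm :: "('a::complex_inner \<Rightarrow> 'a) \<Rightarrow> ('a \<Rightarrow> 'a) \<Rightarrow> real"
  where "aopnorm A T = Sup {anorm A (T x) | x. anorm A x = 1}"

definition anumradius :: "('a::complex_inner \<Rightarrow> 'a) \<Rightarrow> ('a \<Rightarrow> 'a) \<Rightarrow> real"
  where "anumradius A T = Sup {cmod (ainner A (T x) x) | x. anorm A x = 1}"


section \<open>Operator matrices\<close>

definition opmat :: "('d::finite \<Rightarrow> 'd \<Rightarrow> 'a::complex_inner \<Rightarrow> 'a) \<Rightarrow> 'a ^ 'd \<Rightarrow> 'a ^ 'd"
  where "opmat T x = (\<chi> i. \<Sum>j\<in>UNIV. T i j (x $ j))"

definition diag_opmat :: "('a::complex_inner \<Rightarrow> 'a) \<Rightarrow> 'a ^ 'd::finite \<Rightarrow> 'a ^ 'd"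
  where "diag_opmat A = opmat (\<lambda>i j. if i = j then A else (\<lambda>x. 0))"

end

theory Submission
  imports Defs
begin

text \<open>
  Write \<open>\<langle>x, y\<rangle>\<close> and \<open>|x|\<close> for the semi-inner product and seminorm of \<open>A\<close>. For \<open>x\<close> in the direct
  sum put \<open>a i = |x i|\<close>, so that \<open>x\<close> has seminorm 1 if and only if the squares of the
  \<open>a i\<close> add up to 1. The form \<open>\<langle>T x, x\<rangle>\<close> is the sum over the rows \<open>i\<close> of \<open>\<Sum>j. \<langle>T i j (x j), x i\<rangle>\<close>. In modulus, the diagonal
  term of a row is at most \<open>w (a i)\<^sup>2\<close> with \<open>w\<close> the numerical radius of \<open>T i i\<close>, and by the Cauchy-Schwarz
  inequality the others add up to at most \<open>N (a i) b\<close>, where \<open>N\<^sup>2\<close> is the sum of the squared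
  seminorms of the off-diagonal entries and \<open>b\<^sup>2 = 1 - (a i)\<^sup>2\<close>. The maximum of the quadratic form
  \<open>w a\<^sup>2 + N a b\<close> on the unit circle is \<open>(w + sqrt (w\<^sup>2 + N\<^sup>2)) / 2\<close> (\<open>row_form_le\<close>), which is the
  contribution of the row to the bound.

  These estimates bound \<open>|T y|\<close> by \<open>aopnorm A T * |y|\<close> and the modulus of \<open>\<langle>T y, y\<rangle>\<close> by
  \<open>anumradius A T * |y|\<^sup>2\<close>, for an entry \<open>T\<close> of the matrix and all \<open>y\<close>.
  Since a real supremum is an upper bound only of a set that is bounded above, each entry must
  first be shown to be \<open>A\<close>-bounded. If \<open>A X = T\<^sup>* A\<close>, then \<open>S = X T\<close> satisfies
  \<open>\<langle>S x, y\<rangle> = \<langle>T x, T y\<rangle>\<close>, so it is symmetric for the semi-inner product and \<open>|T x|\<^sup>2 \<le> |S x| |x|\<close>.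
  A norm bounded operator that is symmetric in this sense is \<open>A\<close>-bounded
  (\<open>ainner_symmetric_imp_bounded\<close>), by an argument that compares the growth of \<open>|S\<^sup>n x|\<close> with that
  of the norm of \<open>S\<^sup>n x\<close>. That the adjoint \<open>T\<^sup>*\<close> exists at all rests on the Riesz representation
  theorem.
\<close>

section \<open>The Riesz representation and adjoints\<close>

text \<open>
  The representing vector is the minimizer of \<open>\<phi> x = |x|\<^sup>2 - 2 f x\<close>. By the parallelogram law
  every minimizing sequence of \<open>\<phi>\<close> is a Cauchy sequence, so completeness gives a minimizer; the
  derivative of \<open>\<phi>\<close> vanishes there in every direction.
\<close>

lemma riesz_representation_real:
  fixes f :: "'a::{real_inner, complete_space} \<Rightarrow> real"
  assumes "bounded_linear f"
  obtains z where "\<And>x. f x = inner x z"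
proof -
  interpret f: bounded_linear f by fact
  define \<phi> where "\<phi> x = (norm x)\<^sup>2 - 2 * f x" for x
  define m where "m = Inf (range \<phi>)"
  obtain K where K: "\<And>x. \<bar>f x\<bar> \<le> norm x * K"
    using f.bounded by (metis real_norm_def)
  \<comment> \<open>Completing the square: \<open>|x|\<^sup>2 - 2 K |x| = (|x| - K)\<^sup>2 - K\<^sup>2\<close>.\<close>
  have "- K\<^sup>2 \<le> \<phi> x" for x
  proof -
    have "0 \<le> (norm x - K)\<^sup>2" by simp
    then show ?thesis
      using K[of x] by (simp add: \<phi>_def power2_eq_square algebra_simps abs_le_iff)
  qed
  then have bdd: "bdd_below (range \<phi>)" by (intro bdd_belowI[of _ "- K\<^sup>2"]) auto
  have m_le: "m \<le> \<phi> x" for x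
    unfolding m_def using bdd by (simp add: cINF_lower)
  have "\<exists>x. \<phi> x < m + 1 / real (Suc n)" for n
    using cInf_lessD[of "range \<phi>" "m + 1 / real (Suc n)"] by (auto simp: m_def)
  then obtain X where X: "\<And>n. \<phi> (X n) < m + 1 / real (Suc n)" by metis
  have close: "(dist x y)\<^sup>2 \<le> 2 * (\<phi> x - m) + 2 * (\<phi> y - m)" for x y
  proof -
    have "(dist x y)\<^sup>2 = 2 * \<phi> x + 2 * \<phi> y - 4 * \<phi> ((1/2) *\<^sub>R (x + y))"
      by (simp add: \<phi>_def dist_norm power2_norm_eq_inner f.scaleR f.add
          inner_add_left inner_add_right inner_diff_left inner_diff_right inner_commute[of y x]
          algebra_simps)
    then show ?thesis using m_le[of "(1/2) *\<^sub>R (x + y)"] by simp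
  qed
  have "Cauchy X"
  proof (rule metric_CauchyI)
    fix e :: real assume e: "0 < e"
    obtain M where M: "1 / real (Suc M) < e\<^sup>2 / 4"
      using reals_Archimedean[of "e\<^sup>2 / 4"] e by (auto simp: inverse_eq_divide)
    have "dist (X k) (X l) < e" if "k \<ge> M" "l \<ge> M" for k l
    proof -
      have near: "\<phi> (X j) - m < e\<^sup>2 / 4" if "j \<ge> M" for j
      proof -
        have "\<phi> (X j) < m + 1 / real (Suc j)" by (rule X)
        also have "\<dots> \<le> m + 1 / real (Suc M)" using that by (simp add: field_simps)
        also have "\<dots> < m + e\<^sup>2 / 4" using M by simp
        finally show ?thesis by simp
      qed
      have "(dist (X k) (X l))\<^sup>2 \<le> 2 * (\<phi> (X k) - m) + 2 * (\<phi> (X l) - m)"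
        by (rule close)
      also have "\<dots> < 2 * (e\<^sup>2 / 4) + 2 * (e\<^sup>2 / 4)"
        using near[OF that(1)] near[OF that(2)] by (intro add_strict_mono) simp_all
      also have "\<dots> = e\<^sup>2" by simp
      finally have "(dist (X k) (X l))\<^sup>2 < e\<^sup>2" .
      then show ?thesis using e by (simp add: power_less_imp_less_base)
    qed
    then show "\<exists>M. \<forall>k\<ge>M. \<forall>l\<ge>M. dist (X k) (X l) < e" by blast
  qed
  then obtain z where z: "X \<longlonglongrightarrow> z"
    using Cauchy_convergent_iff convergent_def by blast
  have "(\<lambda>n. \<phi> (X n)) \<longlonglongrightarrow> \<phi> z"
    unfolding \<phi>_def by (intro tendsto_intros f.tendsto z)
  moreover have "(\<lambda>n. m + 1 / real (Suc n)) \<longlonglongrightarrow> m"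
    using tendsto_add[OF tendsto_const LIMSEQ_inverse_real_of_nat, of m]
    by (simp add: inverse_eq_divide)
  ultimately have "\<phi> z \<le> m"
    using X by (intro LIMSEQ_le) (auto intro: less_imp_le)
  have "f x = inner x z" for x
  proof (rule ccontr)
    define c where "c = f x - inner x z"
    assume "f x \<noteq> inner x z"
    then have c: "c \<noteq> 0" and x: "x \<noteq> 0" by (auto simp: c_def f.zero)
    \<comment> \<open>This \<open>t\<close> minimizes \<open>\<phi> (z + t x) - \<phi> z = t\<^sup>2 |x|\<^sup>2 - 2 t c\<close>.\<close>
    define t where "t = c / (norm x)\<^sup>2"
    have "\<phi> (z + t *\<^sub>R x) = \<phi> z + t\<^sup>2 * (norm x)\<^sup>2 - 2 * t * c"
      unfolding \<phi>_def c_def power2_norm_eq_inner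
      by (simp add: f.scaleR f.add inner_add_left inner_add_right inner_commute[of z x]
          power2_eq_square algebra_simps)
    also have "\<dots> = \<phi> z - c\<^sup>2 / (norm x)\<^sup>2"
      using x by (simp add: t_def power2_eq_square field_simps)
    also have "\<dots> < \<phi> z" using c x by simp
    finally show False using m_le[of "z + t *\<^sub>R x"] \<open>\<phi> z \<le> m\<close> by simp
  qed
  then show thesis by (rule that)
qed

lemma cinner_scaleC_right: "cinner x (a *\<^sub>C y) = cnj a * cinner x y"
  by (simp add: cinner_commute[of x] cinner_scaleC_left)

lemma cinner_add_right: "cinner x (y + z) = cinner x y + cinner x z"
  by (simp add: cinner_commute[of x] cinner_add_left)

lemma cinner_zero_left [simp]: "cinner 0 x = 0"
  using cinner_add_left[of 0 0 x] by simp

lemma cinner_sum_left: "cinner (sum f S) y = (\<Sum>i\<in>S. cinner (f i) y)"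
  by (induction S rule: infinite_finite_induct) (simp_all add: cinner_add_left)

lemma Im_cinner: "Im (cinner x y) = - Re (cinner (\<i> *\<^sub>C x) y)"
  by (simp add: cinner_scaleC_left)

text \<open>
  The real Riesz theorem represents \<open>x \<mapsto> Re \<langle>T x, y\<rangle>\<close>; the imaginary parts then agree as
  well, because they are the real parts at \<open>\<i> x\<close>.
\<close>

lemma cinner_cadjoint:
  assumes "bounded_clinear T"
  shows "cinner (T x) y = cinner x (cadjoint T y)"
proof -
  interpret bounded_clinear T by fact
  have "\<exists>z. \<forall>x. cinner (T x) y = cinner x z" for y
  proof -
    have "bounded_linear (\<lambda>x. inner (T x) y)"
      by (intro bounded_linear_compose[OF bounded_linear_inner_left] bounded_linear_axioms)
    then obtain z where z: "\<And>x. inner (T x) y = inner x z"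
      using riesz_representation_real by blast
    then have "cinner (T x) y = cinner x z" for x
      by (intro complex_eqI) (simp_all add: Im_cinner scaleC[symmetric] Re_cinner)
    then show ?thesis by blast
  qed
  then have "\<exists>S. \<forall>x y. cinner (T x) y = cinner x (S y)" by metis
  then have "\<forall>x y. cinner (T x) y = cinner x (cadjoint T y)"
    unfolding cadjoint_def by (rule someI_ex)
  then show ?thesis by blast
qed


section \<open>The semi-inner product of a positive operator\<close>

context
  fixes A :: "'h::complex_inner \<Rightarrow> 'h"
  assumes A: "positive_op A"
begin

interpretation A: bounded_clinear A
  using A by (simp add: positive_op_def)

lemma ainner_add_left: "ainner A (x + y) z = ainner A x z + ainner A y z"
  by (simp add: ainner_def A.add cinner_add_left)

lemma ainner_add_right: "ainner A x (y + z) = ainner A x y + ainner A x z"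
  by (simp add: ainner_def cinner_add_right)

lemma ainner_scaleC_left: "ainner A (c *\<^sub>C x) y = c * ainner A x y"
  by (simp add: ainner_def A.scaleC cinner_scaleC_left)

lemma ainner_scaleC_right: "ainner A x (c *\<^sub>C y) = cnj c * ainner A x y"
  by (simp add: ainner_def cinner_scaleC_right)

lemma ainner_sum_left: "ainner A (sum f S) y = (\<Sum>i\<in>S. ainner A (f i) y)"
  by (simp add: ainner_def A.sum cinner_sum_left)

lemma ainner_self_nonneg: "0 \<le> Re (ainner A x x)"
  and Im_ainner_self: "Im (ainner A x x) = 0"
  using A by (auto simp: positive_op_def ainner_def complex_nonneg_Reals_iff)

lemma anorm_nonneg [simp]: "0 \<le> anorm A x"
  by (simp add: anorm_def ainner_self_nonneg)

lemma anorm_square: "(anorm A x)\<^sup>2 = Re (ainner A x x)"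
  by (simp add: anorm_def ainner_self_nonneg)

lemma ainner_self: "ainner A x x = complex_of_real ((anorm A x)\<^sup>2)"
  by (intro complex_eqI) (simp_all add: anorm_square Im_ainner_self)

text \<open>
  Polarization: the values \<open>\<langle>A z, z\<rangle>\<close> at \<open>z = x + y\<close> and \<open>z = x + \<i> y\<close> are real.
\<close>

lemma ainner_commute: "ainner A y x = cnj (ainner A x y)"
proof (rule complex_eqI)
  show "Im (ainner A y x) = Im (cnj (ainner A x y))"
    using Im_ainner_self[of "x + y"]
    by (simp add: ainner_add_left ainner_add_right Im_ainner_self)
  show "Re (ainner A y x) = Re (cnj (ainner A x y))"
    using Im_ainner_self[of "x + \<i> *\<^sub>C y"]
    by (simp add: ainner_add_left ainner_add_right ainner_scaleC_left ainner_scaleC_right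
        Im_ainner_self)
qed

lemma anorm_scaleC: "anorm A (c *\<^sub>C x) = cmod c * anorm A x"
proof -
  have "complex_of_real ((anorm A (c *\<^sub>C x))\<^sup>2) = (c * cnj c) * ainner A x x"
    by (simp only: ainner_self[symmetric] ainner_scaleC_left ainner_scaleC_right mult.assoc
        mult.left_commute)
  also have "\<dots> = complex_of_real ((cmod c * anorm A x)\<^sup>2)"
    by (simp only: complex_norm_square[symmetric] ainner_self power_mult_distrib of_real_mult
        of_real_power)
  finally have "(anorm A (c *\<^sub>C x))\<^sup>2 = (cmod c * anorm A x)\<^sup>2"
    by (simp only: of_real_eq_iff)
  then show ?thesis by (simp add: power2_eq_iff_nonneg)
qed

text \<open>
  The seminorm of \<open>y\<close> may vanish, so the discriminant argument takes the quadratic form of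
  \<open>s x - t y\<close> at all \<open>s\<close> and \<open>t\<close>: the values at \<open>s = |y|\<^sup>2\<close>, \<open>t = Re \<langle>x, y\<rangle>\<close> suffice if \<open>|y| > 0\<close>,
  and if \<open>|y| = 0\<close> the form at \<open>s = 1\<close> is affine in \<open>t\<close> and hence constant.
\<close>

lemma Re_ainner_le: "Re (ainner A x y) \<le> anorm A x * anorm A y"
proof -
  define a b q where "a = (anorm A x)\<^sup>2" and "b = (anorm A y)\<^sup>2" and "q = Re (ainner A x y)"
  have quad: "0 \<le> s\<^sup>2 * a - 2 * s * t * q + t\<^sup>2 * b" for s t :: real
  proof -
    have "(anorm A (s *\<^sub>R x + (- t) *\<^sub>R y))\<^sup>2 = s\<^sup>2 * a - 2 * s * t * q + t\<^sup>2 * b"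
      unfolding anorm_square a_def b_def q_def scaleR_scaleC ainner_add_left ainner_add_right
        ainner_scaleC_left ainner_scaleC_right ainner_commute[of y x]
      by (simp add: power2_eq_square algebra_simps)
    then show ?thesis by (metis zero_le_power2)
  qed
  have "q\<^sup>2 \<le> a * b"
  proof (cases "b = 0")
    case True
    have "q = 0"
    proof (rule ccontr)
      assume "q \<noteq> 0"
      then show False using quad[of 1 "(a + 1) / (2 * q)"] True by simp
    qed
    then show ?thesis using True by simp
  next
    case False
    then have "0 < b" by (simp add: b_def)
    have "0 \<le> b * (a * b - q\<^sup>2)"
      using quad[of b q] by (simp add: power2_eq_square algebra_simps)
    then show ?thesis using \<open>0 < b\<close> by (simp add: zero_le_mult_iff)
  qed
  then have "q\<^sup>2 \<le> (anorm A x * anorm A y)\<^sup>2" by (simp add: a_def b_def power_mult_distrib)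
  then show ?thesis unfolding q_def by (rule power2_le_imp_le) simp
qed

text \<open>A rotation of \<open>x\<close> makes \<open>\<langle>A x, y\<rangle>\<close> real without changing the seminorm of \<open>x\<close>.\<close>

lemma cmod_ainner_le: "cmod (ainner A x y) \<le> anorm A x * anorm A y"
proof (cases "ainner A x y = 0")
  case False
  define c where "c = cnj (sgn (ainner A x y))"
  have "c * ainner A x y = complex_of_real (cmod (ainner A x y))"
    using False
    by (simp add: c_def sgn_eq complex_norm_square[symmetric] mult.commute power2_eq_square)
  moreover have "cmod c = 1" using False by (simp add: c_def norm_sgn)
  ultimately show ?thesis
    using Re_ainner_le[of "c *\<^sub>C x" y] by (simp add: ainner_scaleC_left anorm_scaleC)
qed simp

lemma anorm_bounded: "\<exists>C. \<forall>x. anorm A x \<le> C * norm x"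
proof -
  obtain K where K: "\<And>x. norm (A x) \<le> norm x * K" and "0 \<le> K"
    using A.nonneg_bounded by blast
  have "anorm A x \<le> sqrt K * norm x" for x
  proof (rule power2_le_imp_le)
    have "(anorm A x)\<^sup>2 = inner (A x) x" by (simp add: anorm_square ainner_def Re_cinner)
    also have "\<dots> \<le> norm (A x) * norm x" by (rule norm_cauchy_schwarz)
    also have "\<dots> \<le> norm x * K * norm x" by (intro mult_right_mono K) simp
    finally show "(anorm A x)\<^sup>2 \<le> (sqrt K * norm x)\<^sup>2"
      using \<open>0 \<le> K\<close> by (simp add: power_mult_distrib) (simp add: power2_eq_square algebra_simps)
  qed (use \<open>0 \<le> K\<close> in simp)
  then show ?thesis by blast
qed

lemma normalize_anorm: "anorm A x \<noteq> 0 \<Longrightarrow> anorm A (complex_of_real (1 / anorm A x) *\<^sub>C x) = 1"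
proof -
  assume "anorm A x \<noteq> 0"
  then have "\<bar>1 / anorm A x\<bar> * anorm A x = 1"
    using anorm_nonneg[of x] by simp
  then show ?thesis by (metis anorm_scaleC norm_of_real)
qed

lemma exists_anorm_one:
  assumes "A \<noteq> (\<lambda>x. 0)"
  shows "\<exists>x. anorm A x = 1"
proof -
  obtain x where "A x \<noteq> 0" using assms by (auto simp: fun_eq_iff)
  then have "0 < cmod (ainner A x (A x))" unfolding ainner_def cinner_self by simp
  also have "\<dots> \<le> anorm A x * anorm A (A x)" by (rule cmod_ainner_le)
  finally have "anorm A x \<noteq> 0" by auto
  then show ?thesis using normalize_anorm by blast
qed

end


section \<open>Boundedness with respect to the seminorm\<close>

text \<open>
  A lower bound on log-convex sequences: the ratios \<open>a (n+1) / a n\<close> increase, so the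
  sequence dominates the geometric one with the ratio \<open>a 1 / a 0\<close>.
\<close>

lemma log_convex_ge_power:
  fixes a :: "nat \<Rightarrow> real"
  assumes nonneg: "\<And>n. 0 \<le> a n" and "a 0 = 1"
    and conv: "\<And>n. (a (Suc n))\<^sup>2 \<le> a n * a (Suc (Suc n))"
  shows "a 1 ^ n \<le> a n"
proof -
  have ratio: "a 1 * a n \<le> a (Suc n)" for n
  proof (induction n)
    case 0
    then show ?case using \<open>a 0 = 1\<close> by simp
  next
    case (Suc n)
    show ?case
    proof (cases "a (Suc n) = 0")
      case False
      then have pos: "0 < a (Suc n)" using nonneg[of "Suc n"] by simp
      have "a 1 * (a (Suc n))\<^sup>2 \<le> a 1 * (a n * a (Suc (Suc n)))"
        by (intro mult_left_mono conv nonneg)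
      also have "\<dots> \<le> a (Suc n) * a (Suc (Suc n))"
        using mult_right_mono[OF Suc nonneg[of "Suc (Suc n)"]] by (simp add: mult.assoc)
      finally show ?thesis using pos by (simp add: power2_eq_square)
    qed (simp add: nonneg)
  qed
  show ?thesis
  proof (induction n)
    case (Suc n)
    then show ?case
      using mult_left_mono[OF Suc nonneg[of 1]] ratio[of n] by simp
  qed (simp add: \<open>a 0 = 1\<close>)
qed

lemma power_le_bound_imp_le:
  fixes r K C :: real
  assumes "0 < K" and "\<And>n. r ^ n \<le> C * K ^ n"
  shows "r \<le> K"
proof (rule ccontr)
  assume "\<not> r \<le> K"
  then have "1 < r / K" using assms(1) by simp
  then obtain n where "C < (r / K) ^ n" using real_arch_pow by blast
  then show False using assms(2)[of n] assms(1) by (simp add: power_divide field_simps)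
qed

text \<open>
  Let \<open>|x| = 1\<close> in the seminorm. By symmetry \<open>|S\<^bsup>n+1\<^esup> x|\<^sup>2 = \<langle>S\<^sup>n x, S\<^bsup>n+2\<^esup> x\<rangle>\<close>, so \<open>|S\<^sup>n x|\<close> is
  log-convex and at least \<open>|S x|\<^sup>n\<close>. It is also at most a constant times \<open>K\<^sup>n\<close>, where \<open>K\<close> bounds
  \<open>S\<close> in norm, because the seminorm is at most a multiple of the norm. The constant depends on \<open>x\<close>, but letting
  \<open>n\<close> grow removes it and leaves \<open>|S x| \<le> K\<close>.
\<close>

lemma ainner_symmetric_imp_bounded:
  fixes A S :: "'h::complex_inner \<Rightarrow> 'h"
  assumes A: "positive_op A" and "bounded_linear S"
    and sym: "\<And>x y. ainner A (S x) y = ainner A x (S y)"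
  shows "\<exists>K. \<forall>x. anorm A x = 1 \<longrightarrow> anorm A (S x) \<le> K"
proof -
  interpret S: bounded_linear S by fact
  obtain K where "0 < K" and K: "\<And>x. norm (S x) \<le> norm x * K" using S.pos_bounded by blast
  obtain C where C: "\<And>x. anorm A x \<le> C * norm x" using anorm_bounded[OF A] by blast
  have "anorm A (S x) \<le> K" if "anorm A x = 1" for x
  proof -
    define a where "a n = anorm A ((S ^^ n) x)" for n
    have "(a (Suc n))\<^sup>2 \<le> a n * a (Suc (Suc n))" for n
    proof -
      let ?y = "(S ^^ n) x"
      have "(a (Suc n))\<^sup>2 = Re (ainner A (S ?y) (S ?y))"
        by (simp add: a_def anorm_square[OF A])
      also have "\<dots> = Re (ainner A ?y (S (S ?y)))" by (simp add: sym)
      also have "\<dots> \<le> a n * a (Suc (Suc n))" using Re_ainner_le[OF A] by (simp add: a_def)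
      finally show ?thesis .
    qed
    then have pow: "a 1 ^ n \<le> a n" for n
      by (intro log_convex_ge_power) (simp_all add: a_def anorm_nonneg[OF A] that)
    have iter: "norm ((S ^^ n) x) \<le> norm x * K ^ n" for n
    proof (induction n)
      case (Suc n)
      have "norm ((S ^^ Suc n) x) \<le> norm ((S ^^ n) x) * K" using K by simp
      also have "\<dots> \<le> norm x * K ^ n * K" using Suc \<open>0 < K\<close> by (intro mult_right_mono) auto
      finally show ?case by (simp add: algebra_simps)
    qed simp
    have "a n \<le> (\<bar>C\<bar> * norm x) * K ^ n" for n
    proof -
      have "a n \<le> \<bar>C\<bar> * norm ((S ^^ n) x)"
        unfolding a_def by (rule order_trans[OF C]) (simp add: mult_right_mono)
      also have "\<dots> \<le> \<bar>C\<bar> * (norm x * K ^ n)" by (intro mult_left_mono iter) simp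
      finally show ?thesis by (simp add: mult.assoc)
    qed
    then have "a 1 ^ n \<le> (\<bar>C\<bar> * norm x) * K ^ n" for n
      using pow[of n] order_trans by blast
    with \<open>0 < K\<close> have "a 1 \<le> K" by (rule power_le_bound_imp_le)
    then show ?thesis by (simp add: a_def)
  qed
  then show ?thesis by blast
qed

text \<open>
  If \<open>A X = T\<^sup>* A\<close>, then \<open>A (X T) = T\<^sup>* A T\<close>.
\<close>

lemma B_A_symmetrizer:
  fixes A T :: "'h::chilbert_space \<Rightarrow> 'h"
  assumes A: "positive_op A" and T: "T \<in> B_A A"
  obtains S where "bounded_linear S" "\<And>x y. ainner A (S x) y = ainner A (T x) (T y)"
proof -
  from T obtain X where T: "bounded_clinear T" and X: "bounded_clinear X"
    and AX: "A \<circ> X = cadjoint T \<circ> A"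
    by (auto simp: B_A_def)
  have "bounded_linear (X \<circ> T)"
    using bounded_linear_compose[of X T] T X by (simp add: o_def bounded_clinear_def)
  moreover have "ainner A ((X \<circ> T) x) y = ainner A (T x) (T y)" for x y
  proof -
    have "ainner A ((X \<circ> T) x) y = cinner (cadjoint T (A (T x))) y"
      using fun_cong[OF AX, of "T x"] by (simp add: ainner_def)
    also have "\<dots> = cinner (A (T x)) (T y)"
      using cinner_cadjoint[OF T, of y "A (T x)"] by (metis cinner_commute)
    finally show ?thesis by (simp add: ainner_def)
  qed
  ultimately show thesis by (rule that)
qed

context
  fixes A T :: "'h::chilbert_space \<Rightarrow> 'h"
  assumes A: "positive_op A" and T: "T \<in> B_A A"
begin

interpretation T: bounded_clinear T using T by (simp add: B_A_def)

text \<open>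
  The first inequality transfers the bound from the symmetric operator \<open>S\<close> to \<open>T\<close>; at vectors
  of seminorm zero it shows directly that \<open>T\<close> preserves the null space of the seminorm.
\<close>

lemma anorm_image_square_le:
  "\<exists>S. (\<forall>x. (anorm A (T x))\<^sup>2 \<le> anorm A (S x) * anorm A x) \<and>
    (\<exists>K. \<forall>x. anorm A x = 1 \<longrightarrow> anorm A (S x) \<le> K)"
proof -
  obtain S where S: "bounded_linear S" "\<And>x y. ainner A (S x) y = ainner A (T x) (T y)"
    using A T by (rule B_A_symmetrizer) blast
  have "ainner A (S x) y = ainner A x (S y)" for x y
    by (metis S(2) ainner_commute[OF A])
  then have "\<exists>K. \<forall>x. anorm A x = 1 \<longrightarrow> anorm A (S x) \<le> K"
    using A S(1) by (intro ainner_symmetric_imp_bounded)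
  moreover have "(anorm A (T x))\<^sup>2 \<le> anorm A (S x) * anorm A x" for x
    using Re_ainner_le[OF A, of "S x" x] by (simp add: anorm_square[OF A] S(2))
  ultimately show ?thesis by blast
qed

lemma bdd_above_anorm_image: "bdd_above {anorm A (T x) | x. anorm A x = 1}"
proof -
  obtain S K where S: "\<And>x. (anorm A (T x))\<^sup>2 \<le> anorm A (S x) * anorm A x"
    and K: "\<And>x. anorm A x = 1 \<Longrightarrow> anorm A (S x) \<le> K"
    using anorm_image_square_le by blast
  have "anorm A (T x) \<le> sqrt K" if "anorm A x = 1" for x
    using S[of x] K[OF that] that by (intro real_le_rsqrt) simp
  then show ?thesis by (intro bdd_aboveI[of _ "sqrt K"]) auto
qed

text \<open>
  Vectors of seminorm zero are not multiples of unit vectors; their images have seminorm zero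
  by the inequality \<open>|T x|\<^sup>2 \<le> |S x| |x|\<close>.
\<close>

lemma anorm_image_le: "anorm A (T x) \<le> aopnorm A T * anorm A x"
proof (cases "anorm A x = 0")
  case True
  have "(anorm A (T x))\<^sup>2 \<le> 0"
    using anorm_image_square_le True by (metis mult_zero_right)
  then show ?thesis using True by simp
next
  case False
  define c where "c = complex_of_real (1 / anorm A x)"
  have c: "cmod c = 1 / anorm A x"
    unfolding c_def norm_of_real using anorm_nonneg[OF A] by simp
  have "anorm A (T (c *\<^sub>C x)) \<le> aopnorm A T"
    unfolding aopnorm_def c_def using normalize_anorm[OF A False]
    by (intro cSup_upper bdd_above_anorm_image) blast
  then show ?thesis
    using False anorm_nonneg[OF A, of x]
    by (simp add: T.scaleC anorm_scaleC[OF A] c field_simps)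
qed

lemma cmod_ainner_image_le: "cmod (ainner A (T x) x) \<le> anumradius A T * (anorm A x)\<^sup>2"
proof (cases "anorm A x = 0")
  case True
  then show ?thesis using cmod_ainner_le[OF A, of "T x" x] by simp
next
  case False
  define c where "c = complex_of_real (1 / anorm A x)"
  have c: "cmod c = 1 / anorm A x"
    unfolding c_def norm_of_real using anorm_nonneg[OF A] by simp
  have "cmod (ainner A (T y) y) \<le> aopnorm A T" if "anorm A y = 1" for y
    using cmod_ainner_le[OF A, of "T y" y] anorm_image_le[of y] that by simp
  then have bdd: "bdd_above {cmod (ainner A (T y) y) | y. anorm A y = 1}"
    by (intro bdd_aboveI[of _ "aopnorm A T"]) auto
  have "cmod (ainner A (T (c *\<^sub>C x)) (c *\<^sub>C x)) \<le> anumradius A T"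
    unfolding anumradius_def c_def using normalize_anorm[OF A False]
    by (intro cSup_upper bdd) blast
  then show ?thesis
    using False anorm_nonneg[OF A, of x]
    by (simp add: T.scaleC ainner_scaleC_left[OF A] ainner_scaleC_right[OF A] norm_mult c
        field_simps power2_eq_square)
qed

end


section \<open>Operator matrices\<close>

lemma ainner_diag_opmat: "ainner (diag_opmat A) x y = (\<Sum>i\<in>UNIV. ainner A (x $ i) (y $ i))"
proof -
  have "diag_opmat A x $ i = A (x $ i)" for i
    unfolding diag_opmat_def opmat_def
    by (simp add: if_distrib[of "\<lambda>f. f _"] cong: if_cong)
  then show ?thesis by (simp add: ainner_def cinner_vec_def)
qed

text \<open>
  The number \<open>(w + sqrt (w\<^sup>2 + N\<^sup>2)) / 2\<close> is the largest eigenvalue of the symmetric matrix with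
  rows \<open>(w, N/2)\<close> and \<open>(N/2, 0)\<close>. Directly, twice the left side is \<open>w (a\<^sup>2 + b\<^sup>2)\<close> plus the inner
  product of \<open>(w, N)\<close> and \<open>(a\<^sup>2 - b\<^sup>2, 2 a b)\<close>, and the latter vector has length \<open>a\<^sup>2 + b\<^sup>2\<close>.
\<close>

lemma row_form_le:
  fixes w N a b :: real
  shows "w * a\<^sup>2 + N * (a * b) \<le> 1 / 2 * (w + sqrt (w\<^sup>2 + N\<^sup>2)) * (a\<^sup>2 + b\<^sup>2)"
proof -
  have "(w * (a\<^sup>2 - b\<^sup>2) + N * (2 * a * b))\<^sup>2
      \<le> (w\<^sup>2 + N\<^sup>2) * ((a\<^sup>2 - b\<^sup>2)\<^sup>2 + (2 * a * b)\<^sup>2)"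
    using zero_le_power2[of "w * (2 * a * b) - N * (a\<^sup>2 - b\<^sup>2)"]
    by (simp add: power2_eq_square algebra_simps)
  also have "\<dots> = (sqrt (w\<^sup>2 + N\<^sup>2) * (a\<^sup>2 + b\<^sup>2))\<^sup>2"
    by (simp add: power_mult_distrib) (simp add: power2_eq_square algebra_simps)
  finally have "w * (a\<^sup>2 - b\<^sup>2) + N * (2 * a * b) \<le> sqrt (w\<^sup>2 + N\<^sup>2) * (a\<^sup>2 + b\<^sup>2)"
    by (rule power2_le_imp_le) simp
  then have "2 * (w * a\<^sup>2 + N * (a * b)) \<le> (w + sqrt (w\<^sup>2 + N\<^sup>2)) * (a\<^sup>2 + b\<^sup>2)"
    by (simp add: algebra_simps)
  then show ?thesis by simp
qed

lemma row_sum_le: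
  fixes w :: real and n a :: "'d::finite \<Rightarrow> real"
  assumes nonneg: "\<And>j. 0 \<le> a j" and unit: "(\<Sum>j\<in>UNIV. (a j)\<^sup>2) = 1"
  shows "w * (a i)\<^sup>2 + (\<Sum>j\<in>UNIV - {i}. n j * a j * a i)
    \<le> 1 / 2 * (w + sqrt (w\<^sup>2 + (\<Sum>j\<in>UNIV - {i}. (n j)\<^sup>2)))"
proof -
  define N b where "N = L2_set n (UNIV - {i})" and "b = L2_set a (UNIV - {i})"
  have sq: "(\<Sum>j\<in>UNIV - {i}. (n j)\<^sup>2) = N\<^sup>2" "(\<Sum>j\<in>UNIV - {i}. (a j)\<^sup>2) = b\<^sup>2"
    by (simp_all add: N_def b_def L2_set_def sum_nonneg)
  have "(a i)\<^sup>2 + b\<^sup>2 = 1"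
    unfolding sq(2)[symmetric] unit[symmetric] by (simp add: sum.remove[of UNIV i])
  have "(\<Sum>j\<in>UNIV - {i}. n j * a j * a i) = (\<Sum>j\<in>UNIV - {i}. n j * a j) * a i"
    by (simp add: sum_distrib_right)
  also have "\<dots> \<le> (N * b) * a i"
    unfolding N_def b_def
    by (intro mult_right_mono nonneg order_trans[OF sum_mono L2_set_mult_ineq])
      (simp add: abs_mult[symmetric])
  finally have "w * (a i)\<^sup>2 + (\<Sum>j\<in>UNIV - {i}. n j * a j * a i) \<le> w * (a i)\<^sup>2 + N * (a i * b)"
    by (simp add: algebra_simps)
  also have "\<dots> \<le> 1 / 2 * (w + sqrt (w\<^sup>2 + N\<^sup>2)) * ((a i)\<^sup>2 + b\<^sup>2)" by (rule row_form_le)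
  finally show ?thesis unfolding \<open>(a i)\<^sup>2 + b\<^sup>2 = 1\<close> sq by simp
qed

theorem theorem2p4:
  fixes A :: "'h::chilbert_space \<Rightarrow> 'h"
    and T :: "'d::finite \<Rightarrow> 'd \<Rightarrow> 'h \<Rightarrow> 'h"
  assumes "positive_op A"
    and "A \<noteq> (\<lambda>x. 0)"
    and "\<And>i j. T i j \<in> B_A A"
  shows "anumradius (diag_opmat A) (opmat T)
    \<le> 1 / 2 * (\<Sum>i\<in>UNIV. anumradius A (T i i)
        + sqrt ((anumradius A (T i i))\<^sup>2 + (\<Sum>j\<in>UNIV - {i}. (aopnorm A (T i j))\<^sup>2)))"
proof -
  note A = assms(1) and T = assms(3)
  define w where "w i = anumradius A (T i i)" for i
  define n where "n i j = aopnorm A (T i j)" for i j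
  have bound: "cmod (ainner (diag_opmat A) (opmat T x) x)
      \<le> (\<Sum>i\<in>UNIV. 1 / 2 * (w i + sqrt ((w i)\<^sup>2 + (\<Sum>j\<in>UNIV - {i}. (n i j)\<^sup>2))))"
    if x: "anorm (diag_opmat A) x = 1" for x :: "'h ^ 'd"
  proof -
    define a where "a i = anorm A (x $ i)" for i
    have "(\<Sum>i\<in>UNIV. (a i)\<^sup>2) = 1"
      using x by (simp add: anorm_def[of "diag_opmat A"] ainner_diag_opmat a_def anorm_square[OF A])
    have row: "cmod (ainner A (opmat T x $ i) (x $ i))
        \<le> 1 / 2 * (w i + sqrt ((w i)\<^sup>2 + (\<Sum>j\<in>UNIV - {i}. (n i j)\<^sup>2)))" for i
    proof -
      let ?e = "\<lambda>j. cmod (ainner A (T i j (x $ j)) (x $ i))"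
      have off: "?e j \<le> n i j * a j * a i" for j
        using cmod_ainner_le[OF A, of "T i j (x $ j)" "x $ i"]
          mult_right_mono[OF anorm_image_le[OF A T, of i j "x $ j"] anorm_nonneg[OF A, of "x $ i"]]
        by (simp add: n_def a_def)
      have "cmod (ainner A (opmat T x $ i) (x $ i)) \<le> (\<Sum>j\<in>UNIV. ?e j)"
        by (simp add: opmat_def ainner_sum_left[OF A] norm_sum)
      also have "\<dots> = ?e i + (\<Sum>j\<in>UNIV - {i}. ?e j)" by (simp add: sum.remove[of UNIV i])
      also have "\<dots> \<le> w i * (a i)\<^sup>2 + (\<Sum>j\<in>UNIV - {i}. n i j * a j * a i)"
        using cmod_ainner_image_le[OF A T, of i i "x $ i"] off
        by (intro add_mono sum_mono) (simp_all add: w_def a_def)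
      also have "\<dots> \<le> 1 / 2 * (w i + sqrt ((w i)\<^sup>2 + (\<Sum>j\<in>UNIV - {i}. (n i j)\<^sup>2)))"
        using \<open>(\<Sum>i\<in>UNIV. (a i)\<^sup>2) = 1\<close>
        by (intro row_sum_le) (simp_all add: a_def anorm_nonneg[OF A])
      finally show ?thesis .
    qed
    show ?thesis
      unfolding ainner_diag_opmat by (rule order_trans[OF norm_sum sum_mono]) (rule row)
  qed
  \<comment> \<open>The supremum of the empty set of reals is unspecified, so a unit vector is needed.\<close>
  have "\<exists>x :: 'h ^ 'd. anorm (diag_opmat A) x = 1"
  proof -
    obtain v where v: "anorm A v = 1" using exists_anorm_one[OF A assms(2)] by blast
    fix k :: 'd
    have "Re (ainner (diag_opmat A) (axis k v) (axis k v))
        = (\<Sum>i\<in>UNIV. if i = k then Re (ainner A v v) else 0)"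
      unfolding ainner_diag_opmat Re_sum
      by (intro sum.cong refl) (auto simp: axis_def ainner_def cinner_commute[of _ 0])
    then have "anorm (diag_opmat A) (axis k v) = 1" using v by (simp add: anorm_def)
    then show ?thesis by blast
  qed
  then have "anumradius (diag_opmat A) (opmat T)
      \<le> (\<Sum>i\<in>UNIV. 1 / 2 * (w i + sqrt ((w i)\<^sup>2 + (\<Sum>j\<in>UNIV - {i}. (n i j)\<^sup>2))))"
    unfolding anumradius_def[of "diag_opmat A"] using bound by (intro cSup_least) blast+
  then show ?thesis by (simp only: w_def n_def sum_distrib_left)
qed

end
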